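(* Let $n$ be a nonnegative integer, and let $\mathcal{P}_n(x)$ and $\mathcal{Q}_n(x)$ be the derivative polynomials for hyperbolic tangent and hyperbolic secant, defined by the exponential generating functions $$\frac{x+\tanh (t)}{1+x \tanh (t)}=\sum_{n=0}^{\infty} \mathcal{P}_n(x)\,\frac{t^n}{n!},\qquad \frac{\operatorname{sech}(t)}{1+x \tanh (t)}=\sum_{n=0}^{\infty} \mathcal{Q}_n(x)\,\frac{t^n}{n!}.$$ Then $$\mathcal{P}_n(x)= (-1)^{\frac{n-1}{2}}\,T(n,1) +\sum_{k=1}^{n+1} \frac{(-1)^{\frac{n+k-1}{2}}}{k}\,T(n+1,k)\,x^k$$ and $$\mathcal{Q}_n(x)=\sum_{k=0}^{n} (-1)^{\frac{n+k}{2}}\, S(n,k)\,x^k,$$ where $T(n,k)$ and $S(n,k)$ are the tangent and secant numbers of order $k$.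
   Context: The tangent numbers of order $k$, $T(n,k)$, are defined for integers $k\ge 1$ by the power series expansion at $t=0$ $$\tan^{k}(t)=\sum_{n = k}^{\infty} T(n,k)\,\frac{t^n}{n!},$$ and the secant numbers of order $k$, $S(n,k)$, are defined for integers $k\ge 0$ by $$\sec(t) \tan^{k}(t)=\sum_{n = k}^{\infty} S(n,k)\,\frac{t^n}{n!}.$$ By convention $T(n,k)=0$ and $S(n,k)=0$ for $0\le n<k$ (in particular $T(0,1)=0$). By parity, $T(n,k)$ and $S(n,k)$ also vanish unless $n$ and $k$ have the same parity; hence every term in the formulas whose power of $-1$ has a non-integer exponent has a zero coefficient, and is understood to be $0$ (equivalently, $(-1)^{m/2}$ may be read as $\imath^{m}$, $\imath=\sqrt{-1}$). The generating functions for $\mathcal{P}_n(x)$ and $\mathcal{Q}_n(x)$ are expanded as power series in $t$ at $t=0$, with coefficients polynomials in $x$. *)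

theory Defs
  imports "HOL-Analysis.Analysis"
begin

definition tangent_number :: "nat \<Rightarrow> nat \<Rightarrow> real" where
  "tangent_number n k = fact n * fps_nth (fps_tan 1 ^ k) n"

definition secant_number :: "nat \<Rightarrow> nat \<Rightarrow> real" where
  "secant_number n k = fact n * fps_nth (inverse (fps_cos 1) * fps_tan 1 ^ k) n"

lemma tangent_number_eq_0: "n < k \<Longrightarrow> tangent_number n k = 0"
  by (simp add: tangent_number_def startsby_zero_power_prefix fps_tan_def fps_divide_unit)

lemma secant_number_eq_0: "n < k \<Longrightarrow> secant_number n k = 0"
  by (auto simp: secant_number_def fps_mult_nth startsby_zero_power_prefix fps_tan_def
      fps_divide_unit intro!: sum.neutral)

definition fps_sinh :: "complex fps" where
  "fps_sinh = fps_const (1/2) * (fps_exp 1 - fps_exp (-1))"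

definition fps_cosh :: "complex fps" where
  "fps_cosh = fps_const (1/2) * (fps_exp 1 + fps_exp (-1))"

definition fps_tanh :: "complex fps" where
  "fps_tanh = fps_sinh / fps_cosh"

definition fps_sech :: "complex fps" where
  "fps_sech = inverse fps_cosh"

lemma has_fps_expansion_cosh: "(cosh :: complex \<Rightarrow> complex) has_fps_expansion fps_cosh"
proof -
  have "(\<lambda>t. (1/2) * (exp (1 * t) + exp (-1 * t)) :: complex) has_fps_expansion fps_cosh"
    unfolding fps_cosh_def by (intro fps_expansion_intros)
  then show ?thesis
    by (simp add: cosh_field_def[abs_def])
qed

lemma has_fps_expansion_sinh: "(sinh :: complex \<Rightarrow> complex) has_fps_expansion fps_sinh"
proof -
  have "(\<lambda>t. (1/2) * (exp (1 * t) - exp (-1 * t)) :: complex) has_fps_expansion fps_sinh"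
    unfolding fps_sinh_def by (intro fps_expansion_intros)
  then show ?thesis
    by (simp add: sinh_field_def[abs_def])
qed

lemma fps_cosh_nth_0: "fps_nth fps_cosh 0 = 1"
  by (simp add: fps_cosh_def)

lemma has_fps_expansion_tanh: "(tanh :: complex \<Rightarrow> complex) has_fps_expansion fps_tanh"
  unfolding tanh_def[abs_def] fps_tanh_def
  using has_fps_expansion_sinh has_fps_expansion_cosh fps_cosh_nth_0
  by (intro has_fps_expansion_divide') auto

lemma has_fps_expansion_sech: "(\<lambda>t::complex. inverse (cosh t)) has_fps_expansion fps_sech"
  unfolding fps_sech_def
  using has_fps_expansion_cosh fps_cosh_nth_0 by (intro has_fps_expansion_inverse) auto

text \<open>
  The generating functions are series in \<open>t\<close> (the variable of \<^typ>\<open>complex poly fps\<close>)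
  whose coefficients are polynomials in \<open>x\<close>, where \<open>x\<close> is the polynomial \<open>[:0, 1:]\<close>.
\<close>

definition fps_lift_poly :: "complex fps \<Rightarrow> complex poly fps" where
  "fps_lift_poly f = Abs_fps (\<lambda>n. [:fps_nth f n:])"

text \<open>
  Division of series is not available over a polynomial ring. The common denominator
  has constant coefficient \<open>1\<close>, so it has a two-sided inverse, which
  \<^const>\<open>fps_right_inverse\<close> computes from the inverse \<open>1\<close> of that coefficient.
\<close>

definition gf_denom :: "complex poly fps" where
  "gf_denom = 1 + fps_const [:0, 1:] * fps_lift_poly fps_tanh"

definition tanh_gf :: "complex poly fps" where
  "tanh_gf = (fps_const [:0, 1:] + fps_lift_poly fps_tanh) * fps_right_inverse gf_denom 1"

definition sech_gf :: "complex poly fps" where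
  "sech_gf = fps_lift_poly fps_sech * fps_right_inverse gf_denom 1"

definition tanh_deriv_poly :: "nat \<Rightarrow> complex poly" where
  "tanh_deriv_poly n = fact n * fps_nth tanh_gf n"

definition sech_deriv_poly :: "nat \<Rightarrow> complex poly" where
  "sech_deriv_poly n = fact n * fps_nth sech_gf n"

lemma gf_denom_mult_inverse: "gf_denom * fps_right_inverse gf_denom 1 = 1"
proof (rule fps_right_inverse)
  have "fps_nth fps_tanh 0 = 0"
    by (simp add: fps_tanh_def fps_sinh_def fps_cosh_def fps_divide_unit)
  then show "fps_nth gf_denom 0 * 1 = 1"
    by (simp add: gf_denom_def fps_lift_poly_def)
qed

lemma tanh_gf: "tanh_gf * gf_denom = fps_const [:0, 1:] + fps_lift_poly fps_tanh"
  using gf_denom_mult_inverse by (simp add: tanh_gf_def mult.assoc mult.commute[of _ gf_denom])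

lemma sech_gf: "sech_gf * gf_denom = fps_lift_poly fps_sech"
  using gf_denom_mult_inverse by (simp add: sech_gf_def mult.assoc mult.commute[of _ gf_denom])

end

theory Submission
  imports Defs
begin

text \<open>
  Put \<open>\<tau> = tanh t\<close>. As \<open>\<tau>' = 1 - \<tau>\<^sup>2\<close>, the first generating function is a logarithmic
  derivative up to the summand \<open>\<tau>\<close>:
  \<open>(x + \<tau>) / (1 + x \<tau>) = \<tau> + x (1 - \<tau>\<^sup>2) / (1 + x \<tau>) = \<tau> + (ln (1 + x \<tau>))'\<close>.
  Expanding the logarithm in powers of \<open>x\<close> gives
  \<open>\<tau> + \<Sum>k\<ge>1. (-1)\<^sup>k\<^sup>-\<^sup>1 x\<^sup>k (\<tau>\<^sup>k)' / k\<close>; the derivative accounts for the shift from \<open>n\<close> to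
  \<open>n + 1\<close> and the logarithm for the factor \<open>1 / k\<close>. The second generating function is a plain
  geometric series, \<open>\<Sum>k. (-1)\<^sup>k x\<^sup>k sech t \<tau>\<^sup>k\<close>.

  It remains to compare \<open>\<tau>\<^sup>k\<close> and \<open>sech t \<tau>\<^sup>k\<close> with the series that define the tangent and
  secant numbers: \<open>tan (\<i> t) = \<i> tanh t\<close> and \<open>sec (\<i> t) = sech t\<close>, so the substitution
  \<open>t \<mapsto> \<i> t\<close> turns one family into the other and produces all the powers of \<open>\<i>\<close>.

  Both identities are proved for a fixed complex number \<open>x\<close>, so that all series involved lie in
  the integral domain of complex power series, where common factors such as \<open>cosh t\<close> and
  \<open>1 + x \<tau>\<close> cancel. The passage there from polynomial coefficients, and the substitution of
  \<open>\<i> t\<close> in a real series, are both ring homomorphisms for the same reason, which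
  \<open>fps_map_scale_mult\<close> records.
\<close>

section \<open>Mapping the coefficients of a power series\<close>

text \<open>
  The substitution \<open>t \<mapsto> c t\<close> after applying \<open>h\<close> to each coefficient.
\<close>

definition fps_map_scale :: "'b \<Rightarrow> ('a \<Rightarrow> 'b) \<Rightarrow> 'a::comm_semiring_1 fps \<Rightarrow> 'b::comm_semiring_1 fps"
  where "fps_map_scale c h f = Abs_fps (\<lambda>n. c ^ n * h (fps_nth f n))"

lemma fps_map_scale_nth [simp]: "fps_nth (fps_map_scale c h f) n = c ^ n * h (fps_nth f n)"
  by (simp add: fps_map_scale_def)

locale coeff_hom =
  fixes h :: "'a::comm_semiring_1 \<Rightarrow> 'b::comm_semiring_1"
  assumes hom_0 [simp]: "h 0 = 0"
    and hom_1 [simp]: "h 1 = 1"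
    and hom_add: "h (a + b) = h a + h b"
    and hom_mult: "h (a * b) = h a * h b"
begin

lemma fps_map_scale_1 [simp]: "fps_map_scale c h 1 = 1"
  by (rule fps_ext) simp

lemma fps_map_scale_add: "fps_map_scale c h (f + g) = fps_map_scale c h f + fps_map_scale c h g"
  by (rule fps_ext) (simp add: hom_add distrib_left)

lemma fps_map_scale_mult: "fps_map_scale c h (f * g) = fps_map_scale c h f * fps_map_scale c h g"
proof (rule fps_ext)
  fix n
  have hom_sum: "h (sum u A) = (\<Sum>i\<in>A. h (u i))" for u :: "nat \<Rightarrow> 'a" and A
    using sum_comp_morphism[of h u A] by (simp add: hom_add o_def)
  have "c ^ n * (h (fps_nth f i) * h (fps_nth g (n - i)))
      = c ^ i * h (fps_nth f i) * (c ^ (n - i) * h (fps_nth g (n - i)))" if "i \<in> {0..n}" for i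
  proof -
    have "c ^ n = c ^ i * c ^ (n - i)"
      using that by (simp flip: power_add)
    then show ?thesis
      by (simp add: mult_ac)
  qed
  then show "fps_nth (fps_map_scale c h (f * g)) n
      = fps_nth (fps_map_scale c h f * fps_map_scale c h g) n"
    by (simp add: fps_mult_nth hom_sum hom_mult sum_distrib_left)
qed

lemma fps_map_scale_power: "fps_map_scale c h (f ^ k) = fps_map_scale c h f ^ k"
  by (induction k) (simp_all add: fps_map_scale_mult)

end

section \<open>Tangent and secant under the substitution of \<open>\<i> t\<close>\<close>

interpretation of_real_hom: coeff_hom "of_real :: real \<Rightarrow> complex"
  by unfold_locales simp_all

abbreviation subst_ii :: "real fps \<Rightarrow> complex fps" where
  "subst_ii \<equiv> fps_map_scale \<i> of_real"

lemma fps_cosh_nonzero [simp]: "fps_cosh \<noteq> 0"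
  using fps_cosh_nth_0 by auto

lemma fps_tanh_nth_0 [simp]: "fps_nth fps_tanh 0 = 0"
  by (simp add: fps_tanh_def fps_sinh_def fps_cosh_def fps_divide_unit)

lemma fps_tanh_times_cosh: "fps_tanh * fps_cosh = fps_sinh"
  by (simp add: fps_tanh_def fps_divide_unit fps_cosh_nth_0 mult.assoc inverse_mult_eq_1)

lemma ii_power_times_sign:
  shows "\<i> ^ (2 * m) * (- 1) ^ m = 1" and "\<i> ^ Suc (2 * m) * (- 1) ^ m = \<i>"
proof -
  show even: "\<i> ^ (2 * m) * (- 1) ^ m = 1"
    by (simp add: power_mult)
  show "\<i> ^ Suc (2 * m) * (- 1) ^ m = \<i>"
    unfolding power_Suc mult.assoc even by simp
qed

lemma subst_ii_cos: "subst_ii (fps_cos 1) = fps_cosh"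
proof (rule fps_ext)
  fix n
  show "fps_nth (subst_ii (fps_cos 1)) n = fps_nth fps_cosh n"
  proof (cases "even n")
    case True
    then obtain m where n: "n = 2 * m" ..
    have "fps_nth (subst_ii (fps_cos 1)) n = \<i> ^ (2 * m) * (- 1) ^ m / fact n"
      by (simp add: fps_cos_def n)
    then show ?thesis
      unfolding ii_power_times_sign by (simp add: fps_cosh_def n)
  qed (simp add: fps_cos_def fps_cosh_def)
qed

lemma subst_ii_sin: "subst_ii (fps_sin 1) = fps_const \<i> * fps_sinh"
proof (rule fps_ext)
  fix n
  show "fps_nth (subst_ii (fps_sin 1)) n = fps_nth (fps_const \<i> * fps_sinh) n"
  proof (cases "odd n")
    case True
    then obtain m where n: "n = Suc (2 * m)"
      by (auto elim: oddE)
    have "fps_nth (subst_ii (fps_sin 1)) n = \<i> ^ Suc (2 * m) * (- 1) ^ m / fact n"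
      by (simp add: fps_sin_def n del: power_Suc fact_Suc)
    then show ?thesis
      unfolding ii_power_times_sign by (simp add: fps_sinh_def n del: fact_Suc)
  qed (simp add: fps_sin_def fps_sinh_def)
qed

lemma subst_ii_tan: "subst_ii (fps_tan 1) = fps_const \<i> * fps_tanh"
proof -
  have "fps_tan 1 * fps_cos 1 = (fps_sin 1 :: real fps)"
    by (simp add: fps_tan_def fps_divide_unit mult.assoc inverse_mult_eq_1)
  then have "subst_ii (fps_tan 1) * fps_cosh = fps_const \<i> * fps_sinh"
    by (metis of_real_hom.fps_map_scale_mult subst_ii_cos subst_ii_sin)
  also have "\<dots> = fps_const \<i> * fps_tanh * fps_cosh"
    by (simp add: fps_tanh_times_cosh mult.assoc)
  finally show ?thesis
    by simp
qed

lemma subst_ii_sec: "subst_ii (inverse (fps_cos 1)) = fps_sech"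
proof -
  have "inverse (fps_cos 1) * fps_cos 1 = (1 :: real fps)"
    by (simp add: inverse_mult_eq_1)
  then have "subst_ii (inverse (fps_cos 1)) * fps_cosh = 1"
    by (metis of_real_hom.fps_map_scale_mult of_real_hom.fps_map_scale_1 subst_ii_cos)
  also have "\<dots> = fps_sech * fps_cosh"
    by (simp add: fps_sech_def inverse_mult_eq_1 fps_cosh_nth_0)
  finally show ?thesis
    by simp
qed

text \<open>
  Since \<open>tan (\<i> t) = \<i> tanh t\<close>, the coefficient of degree \<open>n\<close> gains \<open>\<i>\<^sup>n\<close> from the
  substitution, while each of the \<open>k\<close> factors \<open>tanh t\<close> costs \<open>1 / \<i> = -\<i>\<close>.
\<close>

lemma fact_times_tanh_power_nth:
  "fact n * fps_nth (fps_tanh ^ k) n = (-\<i>) ^ k * \<i> ^ n * of_real (tangent_number n k)"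
proof -
  have "subst_ii (fps_tan 1 ^ k) = fps_const (\<i> ^ k) * fps_tanh ^ k"
    by (simp add: of_real_hom.fps_map_scale_power subst_ii_tan power_mult_distrib fps_const_power)
  then have "\<i> ^ n * of_real (fps_nth (fps_tan 1 ^ k) n) = \<i> ^ k * fps_nth (fps_tanh ^ k) n"
    by (metis fps_map_scale_nth fps_mult_left_const_nth)
  then have "(-\<i>) ^ k * (\<i> ^ n * of_real (fps_nth (fps_tan 1 ^ k) n))
      = ((-\<i>) * \<i>) ^ k * fps_nth (fps_tanh ^ k) n"
    by (simp only: power_mult_distrib mult.assoc)
  then show ?thesis
    by (simp add: tangent_number_def mult_ac)
qed

lemma fact_times_sech_tanh_power_nth:
  "fact n * fps_nth (fps_sech * fps_tanh ^ k) n
     = (-\<i>) ^ k * \<i> ^ n * of_real (secant_number n k)"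
proof -
  have "subst_ii (inverse (fps_cos 1) * fps_tan 1 ^ k)
      = fps_const (\<i> ^ k) * (fps_sech * fps_tanh ^ k)"
    by (simp add: of_real_hom.fps_map_scale_mult of_real_hom.fps_map_scale_power
        subst_ii_tan subst_ii_sec power_mult_distrib fps_const_power mult_ac)
  then have "\<i> ^ n * of_real (fps_nth (inverse (fps_cos 1) * fps_tan 1 ^ k) n)
      = \<i> ^ k * fps_nth (fps_sech * fps_tanh ^ k) n"
    by (metis fps_map_scale_nth fps_mult_left_const_nth)
  then have "(-\<i>) ^ k * (\<i> ^ n * of_real (fps_nth (inverse (fps_cos 1) * fps_tan 1 ^ k) n))
      = ((-\<i>) * \<i>) ^ k * fps_nth (fps_sech * fps_tanh ^ k) n"
    by (simp only: power_mult_distrib mult.assoc)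
  then show ?thesis
    by (simp add: secant_number_def mult_ac)
qed

section \<open>The generating functions at a fixed point\<close>

text \<open>
  With \<open>\<tau> cosh = sinh\<close> the product rule gives \<open>\<tau>' cosh + \<tau> sinh = cosh\<close>, from which
  \<open>cosh\<close> cancels.
\<close>

lemma fps_deriv_tanh: "fps_deriv fps_tanh = 1 - fps_tanh\<^sup>2"
proof -
  have "fps_deriv fps_sinh = fps_cosh" "fps_deriv fps_cosh = fps_sinh"
    by (simp_all add: fps_sinh_def fps_cosh_def algebra_simps flip: fps_const_neg)
  then have "fps_deriv fps_tanh * fps_cosh + fps_tanh * fps_sinh = fps_cosh"
    using arg_cong[OF fps_tanh_times_cosh, of fps_deriv] by (simp add: add_ac mult_ac)
  then have "fps_deriv fps_tanh * fps_cosh = (1 - fps_tanh\<^sup>2) * fps_cosh"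
    by (simp add: algebra_simps power2_eq_square flip: fps_tanh_times_cosh)
  then show ?thesis
    by simp
qed

text \<open>
  Only finitely many powers of \<open>g\<close> reach degree \<open>n\<close>, since \<open>g\<close> has no constant term.
\<close>

lemma fps_mult_compose_nth:
  fixes f g a :: "'a::idom fps"
  assumes "fps_nth g 0 = 0"
  shows "fps_nth (f * (a oo g)) n = (\<Sum>k=0..n. fps_nth a k * fps_nth (f * g ^ k) n)"
proof -
  have compose: "fps_nth (a oo g) m = (\<Sum>k=0..n. fps_nth a k * fps_nth (g ^ k) m)" if "m \<le> n" for m
    unfolding fps_compose_nth using that assms
    by (intro sum.mono_neutral_left) (auto simp: startsby_zero_power_prefix)
  have "fps_nth (f * (a oo g)) n
      = (\<Sum>i=0..n. \<Sum>k=0..n. fps_nth f i * (fps_nth a k * fps_nth (g ^ k) (n - i)))"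
    by (simp add: fps_mult_nth compose sum_distrib_left)
  also have "\<dots> = (\<Sum>k=0..n. fps_nth a k * fps_nth (f * g ^ k) n)"
    by (subst sum.swap) (simp add: fps_mult_nth sum_distrib_left mult_ac)
  finally show ?thesis .
qed

text \<open>
  The series of \<open>1 / (1 + x t)\<close> and of \<open>ln (1 + x t)\<close>. Composing them with \<open>tanh\<close> keeps
  the expansions in powers of \<open>x\<close> as finite sums in each coefficient, with no need for a series
  in two variables.
\<close>

definition fps_geometric :: "'a::field \<Rightarrow> 'a fps" where
  "fps_geometric x = Abs_fps (\<lambda>k. (- x) ^ k)"

definition fps_ln_one_plus :: "'a::field_char_0 \<Rightarrow> 'a fps" where
  "fps_ln_one_plus x = Abs_fps (\<lambda>k. if k = 0 then 0 else (- 1) ^ (k - 1) * x ^ k / of_nat k)"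

lemma fps_geometric_compose_mult:
  assumes "fps_nth g 0 = 0"
  shows "(fps_geometric x oo g) * (1 + fps_const x * g) = 1"
proof -
  have "fps_geometric x * (1 + fps_const x * fps_X) = 1"
  proof (rule fps_ext)
    show "fps_nth (fps_geometric x * (1 + fps_const x * fps_X)) n = fps_nth 1 n" for n
      by (cases n) (simp_all add: fps_geometric_def distrib_left mult.assoc[symmetric])
  qed
  then have "(fps_geometric x * (1 + fps_const x * fps_X)) oo g = 1"
    by simp
  then show ?thesis
    using assms by (simp add: fps_compose_mult_distrib fps_compose_add_distrib)
qed

lemma fps_deriv_ln_one_plus: "fps_deriv (fps_ln_one_plus x) = fps_const x * fps_geometric x"
  by (rule fps_ext)
    (simp add: fps_ln_one_plus_def fps_geometric_def power_minus[of x] del: of_nat_Suc)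

lemma coeff_hom_poly: "coeff_hom (\<lambda>p. poly p x)"
  by unfold_locales simp_all

abbreviation eval_coeffs :: "complex \<Rightarrow> complex poly fps \<Rightarrow> complex fps" where
  "eval_coeffs x \<equiv> fps_map_scale 1 (\<lambda>p. poly p x)"

lemmas eval_coeffs_add = coeff_hom.fps_map_scale_add[OF coeff_hom_poly]
  and eval_coeffs_mult = coeff_hom.fps_map_scale_mult[OF coeff_hom_poly]
  and eval_coeffs_1 = coeff_hom.fps_map_scale_1[OF coeff_hom_poly]

lemma eval_coeffs_lift [simp]: "eval_coeffs x (fps_lift_poly f) = f"
  by (rule fps_ext) (simp add: fps_lift_poly_def)

lemma eval_coeffs_variable [simp]: "eval_coeffs x (fps_const [:0, 1:]) = fps_const x"
  by (rule fps_ext) simp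

lemma eval_coeffs_denom: "eval_coeffs x gf_denom = 1 + fps_const x * fps_tanh"
  by (simp add: gf_denom_def eval_coeffs_add eval_coeffs_mult eval_coeffs_1)

lemma eval_sech_gf: "eval_coeffs x sech_gf = fps_sech * (fps_geometric x oo fps_tanh)"
proof -
  let ?d = "1 + fps_const x * fps_tanh" and ?r = "fps_geometric x oo fps_tanh"
  have gf: "eval_coeffs x sech_gf * ?d = fps_sech"
    using arg_cong[OF sech_gf, of "eval_coeffs x"]
    by (simp add: eval_coeffs_mult eval_coeffs_denom)
  have inv: "?r * ?d = 1"
    by (rule fps_geometric_compose_mult) simp
  have "eval_coeffs x sech_gf = eval_coeffs x sech_gf * (?r * ?d)"
    by (simp only: inv mult_1_right)
  also have "\<dots> = eval_coeffs x sech_gf * ?d * ?r"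
    by (simp only: mult_ac)
  finally show ?thesis
    unfolding gf .
qed

text \<open>
  Multiplied by \<open>1 + x \<tau>\<close>, the right-hand side becomes
  \<open>\<tau> (1 + x \<tau>) + x \<tau>' = \<tau> + x \<tau>\<^sup>2 + x (1 - \<tau>\<^sup>2) = x + \<tau>\<close>.
\<close>

lemma eval_tanh_gf:
  "eval_coeffs x tanh_gf = fps_tanh + fps_deriv (fps_ln_one_plus x oo fps_tanh)"
proof -
  let ?d = "1 + fps_const x * fps_tanh" and ?r = "fps_geometric x oo fps_tanh"
  have gf: "eval_coeffs x tanh_gf * ?d = fps_const x + fps_tanh"
    using arg_cong[OF tanh_gf, of "eval_coeffs x"]
    by (simp add: eval_coeffs_mult eval_coeffs_add eval_coeffs_denom)
  have inv: "?r * ?d = 1"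
    by (rule fps_geometric_compose_mult) simp
  have deriv: "fps_deriv (fps_ln_one_plus x oo fps_tanh) = fps_const x * ?r * (1 - fps_tanh\<^sup>2)"
    by (simp add: fps_compose_deriv fps_deriv_ln_one_plus fps_deriv_tanh fps_compose_mult_distrib)
  have "(fps_tanh + fps_deriv (fps_ln_one_plus x oo fps_tanh)) * ?d
      = fps_tanh * ?d + fps_const x * (1 - fps_tanh\<^sup>2) * (?r * ?d)"
    unfolding distrib_right[of fps_tanh] deriv by (simp only: mult_ac)
  also have "\<dots> = fps_const x + fps_tanh"
    unfolding inv by (simp add: algebra_simps power2_eq_square)
  finally have "(fps_tanh + fps_deriv (fps_ln_one_plus x oo fps_tanh)) * ?d
      = eval_coeffs x tanh_gf * ?d"
    using gf by simp
  moreover have "?d \<noteq> 0"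
    using inv by auto
  ultimately show ?thesis
    by simp
qed

section \<open>The coefficients\<close>

lemma poly_fact: "poly (fact n) (x::complex) = fact n"
  by (metis of_nat_fact poly_of_nat)

lemma poly_sech_deriv_poly:
  "poly (sech_deriv_poly n) x = (\<Sum>k=0..n. \<i> ^ (n + k) * of_real (secant_number n k) * x ^ k)"
proof -
  have "poly (sech_deriv_poly n) x = fact n * fps_nth (eval_coeffs x sech_gf) n"
    by (simp add: sech_deriv_poly_def poly_fact)
  also have "\<dots> = (\<Sum>k=0..n. (- x) ^ k * (fact n * fps_nth (fps_sech * fps_tanh ^ k) n))"
    by (simp add: eval_sech_gf fps_mult_compose_nth fps_geometric_def sum_distrib_left mult_ac)
  also have "\<dots> = (\<Sum>k=0..n. \<i> ^ (n + k) * of_real (secant_number n k) * x ^ k)"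
  proof (rule sum.cong)
    fix k
    have "(- x) ^ k * (-\<i>) ^ k = \<i> ^ k * x ^ k"
      by (simp add: mult.commute flip: power_mult_distrib)
    then show "(- x) ^ k * (fact n * fps_nth (fps_sech * fps_tanh ^ k) n)
        = \<i> ^ (n + k) * of_real (secant_number n k) * x ^ k"
      by (simp add: fact_times_sech_tanh_power_nth power_add mult_ac)
  qed simp
  finally show ?thesis .
qed

lemma poly_tanh_deriv_poly:
  "poly (tanh_deriv_poly n) x =
      \<i> powi (int n - 1) * of_real (tangent_number n 1)
      + (\<Sum>k=1..n+1. \<i> ^ (n + k - 1) / of_nat k * of_real (tangent_number (n + 1) k) * x ^ k)"
proof -
  let ?L = "fps_ln_one_plus x"
  have "poly (tanh_deriv_poly n) x = fact n * fps_nth (eval_coeffs x tanh_gf) n"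
    by (simp add: tanh_deriv_poly_def poly_fact)
  also have "\<dots> = fact n * fps_nth fps_tanh n + fact (n + 1) * fps_nth (?L oo fps_tanh) (n + 1)"
    by (simp add: eval_tanh_gf algebra_simps)
  also have "fact n * fps_nth fps_tanh n = \<i> powi (int n - 1) * of_real (tangent_number n 1)"
    using fact_times_tanh_power_nth[of n 1] by (simp add: power_int_diff)
  also have "fact (n + 1) * fps_nth (?L oo fps_tanh) (n + 1)
      = (\<Sum>k=0..n+1. fps_nth ?L k * (fact (n + 1) * fps_nth (fps_tanh ^ k) (n + 1)))"
    unfolding fps_compose_nth sum_distrib_left by (simp only: mult_ac)
  also have "\<dots> = (\<Sum>k=1..n+1. fps_nth ?L k * (fact (n + 1) * fps_nth (fps_tanh ^ k) (n + 1)))"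
    by (rule sum.mono_neutral_right) (auto simp: fps_ln_one_plus_def Suc_le_eq)
  also have "\<dots> = (\<Sum>k=1..n+1. \<i> ^ (n + k - 1) / of_nat k * of_real (tangent_number (n + 1) k) * x ^ k)"
  proof (rule sum.cong)
    fix k assume "k \<in> {1..n+1}"
    then obtain j where k: "k = Suc j"
      by (cases k) auto
    have "(- 1) ^ j * (-\<i>) ^ j = \<i> ^ j"
      by (simp flip: power_mult_distrib)
    \<comment> \<open>The remaining factor is \<open>(-\<i>) * \<i> = 1\<close>: one \<open>-\<i>\<close> from \<open>k = j + 1\<close>, one \<open>\<i>\<close> from \<open>n + 1\<close>.\<close>
    then have "(- 1) ^ j * ((-\<i>) ^ k * \<i> ^ (n + 1)) = \<i> ^ (n + k - 1)"
      by (simp add: k power_add mult_ac)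
    then show "fps_nth ?L k * (fact (n + 1) * fps_nth (fps_tanh ^ k) (n + 1))
        = \<i> ^ (n + k - 1) / of_nat k * of_real (tangent_number (n + 1) k) * x ^ k"
      unfolding fact_times_tanh_power_nth
      by (simp add: k fps_ln_one_plus_def mult_ac del: of_nat_Suc power_Suc)
  qed simp
  finally show ?thesis .
qed

theorem theorem2:
  fixes n :: nat and x :: complex
  shows "poly (tanh_deriv_poly n) x =
      \<i> powi (int n - 1) * of_real (tangent_number n 1)
      + (\<Sum>k=1..n+1. \<i> ^ (n + k - 1) / of_nat k * of_real (tangent_number (n + 1) k) * x ^ k)
    \<and> poly (sech_deriv_poly n) x =
      (\<Sum>k=0..n. \<i> ^ (n + k) * of_real (secant_number n k) * x ^ k)"
  using poly_tanh_deriv_poly poly_sech_deriv_poly by blast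

end
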